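(* Let $p\le q+1$ and $n\in\mathbb{N}_0$. Then, for parameters and $z$ for which the extended generalized hypergeometric function is defined, $$ \frac{d^n}{dz^n}\left\{{}_{p}F_{q}^{(\kappa_l)}\left[\begin{array}{ccc}\alpha_1&\cdots&\alpha_p\\ \beta_1&\cdots&\beta_q\end{array};z;b,d\right]\right\}=\frac{(\alpha_1)_n\cdots(\alpha_p)_n}{(\beta_1)_n\cdots(\beta_q)_n}\;{}_{p}F_{q}^{(\kappa_l)}\left[\begin{array}{ccc}\alpha_1+n&\cdots&\alpha_p+n\\ \beta_1+n&\cdots&\beta_q+n\end{array};z;b,d\right]. $$
   Context: Here $(a)_m=\Gamma(a+m)/\Gamma(a)$ is the Pochhammer symbol and $B(\cdot,\cdot)$ is Euler's beta function. Let $\{\kappa_l\}_{l\ge0}$ be a complex sequence with $\kappa_0=1$ and let $\Theta(z)=\Theta(\kappa_l;z)$ be a function analytic in a disk $|z|<R$ ($0<R<\infty$) with $\Theta(z)=\sum_{l\ge0}\kappa_l z^l/l!$ there, continued analytically to the half-plane $\Re(z)>0$ with $\Theta(z)=M_0z^{\omega}e^{z}[1+O(1/z)]$ as $\Re(z)\to\infty$ ($M_0>0$, $\omega\in\mathbb{C}$). It is also understood that $\Theta$ is defined and continuous on $\Re(z)\le 0$ and that the following integrals converge absolutely. For $\Re(b),\Re(d)\ge0$ and $\Re(\alpha),\Re(\beta)>0$, $$\mathcal{B}^{(\kappa_l)}_{b,d}(\alpha,\beta)=\int_0^1t^{\alpha-1}(1-t)^{\beta-1}\Theta\left(-\frac bt-\frac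 d{1-t}\right)dt .$$ The extended generalized hypergeometric function ${}_pF_q^{(\kappa_l)}\left[\begin{array}{ccc}\alpha_1&\cdots&\alpha_p\\ \beta_1&\cdots&\beta_q\end{array};z;b,d\right]$ is defined by: (i) if $p=q+1$, $|z|<1$, $\Re(\beta_j)>\Re(\alpha_{j+1})>0$ for $1\le j\le q$: $\displaystyle\sum_{m\ge0}(\alpha_1)_m\prod_{j=1}^q\frac{\mathcal{B}^{(\kappa_l)}_{b,d}(\alpha_{j+1}+m,\beta_j-\alpha_{j+1})}{B(\alpha_{j+1},\beta_j-\alpha_{j+1})}\frac{z^m}{m!}$; (ii) if $p=q$, $z\in\mathbb{C}$, $\Re(\beta_j)>\Re(\alpha_j)>0$ for $1\le j\le q$: $\displaystyle\sum_{m\ge0}\prod_{j=1}^q\frac{\mathcal{B}^{(\kappa_l)}_{b,d}(\alpha_j+m,\beta_j-\alpha_j)}{B(\alpha_j,\beta_j-\alpha_j)}\frac{z^m}{m!}$; (iii) if $p<q$, $r=q-p$, $z\in\mathbb{C}$, $\Re(\beta_{r+j})>\Re(\alpha_j)>0$ for $1\le j\le p$, and none of $\beta_1,\dots,\beta_r$ is zero or a negative integer: $\displaystyle\sum_{m\ge0}\frac1{(\beta_1)_m\cdots(\beta_r)_m}\prod_{j=1}^p\frac{\mathcal{B}^{(\kappa_l)}_{b,d}(\alpha_j+m,\beta_{r+j}-\alpha_j)}{B(\alpha_j,\beta_{r+j}-\alpha_j)}\frac{z^m}{m!}$. Empty products equal $1$. *)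

theory Defs
  imports "HOL-Analysis.Analysis" "HOL-Library.Landau_Symbols"
begin

text \<open>
  The expansion at infinity is uniform in the direction: \<open>Re z\<close> tends to infinity with \<open>Im z\<close>
  unrestricted. The power \<open>z powr \<omega>\<close> is the principal branch, which is analytic for \<open>Re z > 0\<close>.
\<close>

definition ext_kernel ::
    "(nat \<Rightarrow> complex) \<Rightarrow> real \<Rightarrow> real \<Rightarrow> complex \<Rightarrow> (complex \<Rightarrow> complex) \<Rightarrow> bool" where
  "ext_kernel \<kappa> R M\<^sub>0 \<omega> \<Theta> \<longleftrightarrow>
     \<kappa> 0 = 1 \<and> R > 0 \<and> M\<^sub>0 > 0 \<and>
     (\<forall>z\<in>ball 0 R. (\<lambda>l. \<kappa> l * z ^ l / fact l) sums \<Theta> z) \<and>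
     \<Theta> holomorphic_on (ball 0 R \<union> {z. Re z > 0}) \<and>
     (\<exists>\<epsilon>. \<epsilon> \<in> O[filtercomap Re at_top](\<lambda>z. 1 / z) \<and>
          (\<forall>\<^sub>F z in filtercomap Re at_top.
             \<Theta> z = of_real M\<^sub>0 * z powr \<omega> * exp z * (1 + \<epsilon> z))) \<and>
     continuous_on {z. Re z \<le> 0} \<Theta>"

definition ext_beta_integrand ::
    "(complex \<Rightarrow> complex) \<Rightarrow> complex \<Rightarrow> complex \<Rightarrow> complex \<Rightarrow> complex \<Rightarrow> real \<Rightarrow> complex" where
  "ext_beta_integrand \<Theta> b d x y t =
     of_real t powr (x - 1) * of_real (1 - t) powr (y - 1) *
     \<Theta> (- (b / of_real t) - d / of_real (1 - t))"

definition ext_beta ::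
    "(complex \<Rightarrow> complex) \<Rightarrow> complex \<Rightarrow> complex \<Rightarrow> complex \<Rightarrow> complex \<Rightarrow> complex" where
  "ext_beta \<Theta> b d x y = (LINT t:{0<..<1}|lborel. ext_beta_integrand \<Theta> b d x y t)"

definition ext_beta_converges ::
    "(complex \<Rightarrow> complex) \<Rightarrow> complex \<Rightarrow> complex \<Rightarrow> complex \<Rightarrow> complex \<Rightarrow> bool" where
  "ext_beta_converges \<Theta> b d x y \<longleftrightarrow>
     set_integrable lborel {0<..<1} (ext_beta_integrand \<Theta> b d x y)"

text \<open>
  The parameters are \<open>\<alpha> 1, \<dots>, \<alpha> p\<close> and \<open>\<beta> 1, \<dots>, \<beta> q\<close>; other values of \<open>\<alpha>\<close> and \<open>\<beta>\<close> are
  irrelevant. The value \<open>0\<close> for \<open>p > q + 1\<close> is a dummy.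
\<close>

definition ext_hyp_coeff ::
    "(complex \<Rightarrow> complex) \<Rightarrow> nat \<Rightarrow> nat \<Rightarrow> (nat \<Rightarrow> complex) \<Rightarrow> (nat \<Rightarrow> complex) \<Rightarrow>
     complex \<Rightarrow> complex \<Rightarrow> nat \<Rightarrow> complex" where
  "ext_hyp_coeff \<Theta> p q \<alpha> \<beta> b d m =
     (if p = q + 1 then
        pochhammer (\<alpha> 1) m *
        (\<Prod>j=1..q. ext_beta \<Theta> b d (\<alpha> (j + 1) + of_nat m) (\<beta> j - \<alpha> (j + 1)) /
                   Beta (\<alpha> (j + 1)) (\<beta> j - \<alpha> (j + 1)))
      else if p = q then
        (\<Prod>j=1..q. ext_beta \<Theta> b d (\<alpha> j + of_nat m) (\<beta> j - \<alpha> j) /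
                   Beta (\<alpha> j) (\<beta> j - \<alpha> j))
      else if p < q then
        1 / (\<Prod>j=1..q - p. pochhammer (\<beta> j) m) *
        (\<Prod>j=1..p. ext_beta \<Theta> b d (\<alpha> j + of_nat m) (\<beta> (q - p + j) - \<alpha> j) /
                   Beta (\<alpha> j) (\<beta> (q - p + j) - \<alpha> j))
      else 0)"

definition ext_hyp ::
    "(complex \<Rightarrow> complex) \<Rightarrow> nat \<Rightarrow> nat \<Rightarrow> (nat \<Rightarrow> complex) \<Rightarrow> (nat \<Rightarrow> complex) \<Rightarrow>
     complex \<Rightarrow> complex \<Rightarrow> complex \<Rightarrow> complex" where
  "ext_hyp \<Theta> p q \<alpha> \<beta> b d z = (\<Sum>m. ext_hyp_coeff \<Theta> p q \<alpha> \<beta> b d m * z ^ m / fact m)"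

text \<open>
  Besides the inequalities on the parameters, being defined includes the absolute convergence of
  the beta integrals that occur in the coefficients; no other integrals are required to converge.
\<close>

definition ext_hyp_defined ::
    "(complex \<Rightarrow> complex) \<Rightarrow> nat \<Rightarrow> nat \<Rightarrow> (nat \<Rightarrow> complex) \<Rightarrow> (nat \<Rightarrow> complex) \<Rightarrow>
     complex \<Rightarrow> complex \<Rightarrow> complex \<Rightarrow> bool" where
  "ext_hyp_defined \<Theta> p q \<alpha> \<beta> b d z \<longleftrightarrow>
     Re b \<ge> 0 \<and> Re d \<ge> 0 \<and>
     (if p = q + 1 then
        norm z < 1 \<and>
        (\<forall>j\<in>{1..q}. Re (\<beta> j) > Re (\<alpha> (j + 1)) \<and> Re (\<alpha> (j + 1)) > 0 \<and>
           (\<forall>m. ext_beta_converges \<Theta> b d (\<alpha> (j + 1) + of_nat m) (\<beta> j - \<alpha> (j + 1))))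
      else if p = q then
        (\<forall>j\<in>{1..q}. Re (\<beta> j) > Re (\<alpha> j) \<and> Re (\<alpha> j) > 0 \<and>
           (\<forall>m. ext_beta_converges \<Theta> b d (\<alpha> j + of_nat m) (\<beta> j - \<alpha> j)))
      else if p < q then
        (\<forall>j\<in>{1..p}. Re (\<beta> (q - p + j)) > Re (\<alpha> j) \<and> Re (\<alpha> j) > 0 \<and>
           (\<forall>m. ext_beta_converges \<Theta> b d (\<alpha> j + of_nat m) (\<beta> (q - p + j) - \<alpha> j))) \<and>
        (\<forall>j\<in>{1..q - p}. \<beta> j \<notin> \<int>\<^sub>\<le>\<^sub>0)
      else False)"

end

theory Submission
  imports Defs
begin

text \<open>
  The extended hypergeometric function is a power series \<open>\<Sum>m. c m * z ^ m / fact m\<close>, whose \<open>n\<close>-th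
  derivative has the coefficients \<open>c (m + n)\<close>. Since \<open>Beta (x + n) y\<close> equals
  \<open>Beta x y * pochhammer x n / pochhammer (x + y) n\<close>, these are, up to the constant factor of the
  theorem, the coefficients with all parameters shifted by \<open>n\<close>. Convergence holds because
  \<open>t ^ m \<le> 1\<close> on the unit interval bounds the extended beta integrals uniformly in \<open>m\<close>.
\<close>

section \<open>Termwise differentiation of power series with coefficients divided by
  factorials\<close>

lemma diffs_div_fact: "diffs (\<lambda>m. c m / fact m) = (\<lambda>m. c (Suc m) / fact m)"
  for c :: "nat \<Rightarrow> complex"
  by (auto simp: diffs_def fun_eq_iff field_simps fact_Suc simp del: of_nat_Suc)

lemma exp_type_series_summable_Suc:
  fixes c :: "nat \<Rightarrow> complex"
  assumes "\<And>w. norm w < r \<Longrightarrow> summable (\<lambda>m. c m * w ^ m / fact m)" and "norm z < r"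
  shows "summable (\<lambda>m. c (Suc m) * z ^ m / fact m)"
proof -
  have "summable (\<lambda>m. diffs (\<lambda>m. c m / fact m) m * z ^ m)"
    using assms by (intro termdiff_converges[of _ r]) auto
  then show ?thesis by (simp add: diffs_div_fact)
qed

lemma exp_type_series_DERIV:
  fixes c :: "nat \<Rightarrow> complex"
  assumes "\<And>w. norm w < r \<Longrightarrow> summable (\<lambda>m. c m * w ^ m / fact m)" and "norm z < r"
  shows "((\<lambda>w. \<Sum>m. c m * w ^ m / fact m) has_field_derivative
           (\<Sum>m. c (Suc m) * z ^ m / fact m)) (at z)"
proof -
  let ?a = "\<lambda>m. c m / fact m"
  \<comment> \<open>\<open>termdiffs_strong\<close> wants convergence at one point of norm larger
    than \<open>norm z\<close>, and the real number \<open>s\<close> serves as that point.\<close>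
  obtain s where s: "norm z < s" "s < r" using assms(2) dense by blast
  then have "s > 0" using norm_ge_zero[of z] by linarith
  then have "norm (of_real s :: complex) = s" by simp
  then have "((\<lambda>w. \<Sum>m. ?a m * w ^ m) has_field_derivative (\<Sum>m. diffs ?a m * z ^ m)) (at z)"
    using s assms(1)[of "of_real s"] by (intro termdiffs_strong[of _ "of_real s"]) auto
  then show ?thesis by (simp add: diffs_div_fact)
qed

text \<open>The factorials absorb the factors that differentiation produces, so each derivative only
  shifts the index of \<open>c\<close>. Since \<open>deriv\<close> is total, the second conjunct is
  what makes its iterates genuine derivatives.\<close>

lemma exp_type_series_higher_deriv:
  fixes c :: "nat \<Rightarrow> complex"
  assumes "\<And>w. norm w < r \<Longrightarrow> summable (\<lambda>m. c m * w ^ m / fact m)" and "norm z < r"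
  shows "(deriv ^^ k) (\<lambda>w. \<Sum>m. c m * w ^ m / fact m) z = (\<Sum>m. c (m + k) * z ^ m / fact m) \<and>
         (deriv ^^ k) (\<lambda>w. \<Sum>m. c m * w ^ m / fact m) field_differentiable at z"
proof -
  define F where "F = (\<lambda>k w. \<Sum>m. c (m + k) * w ^ m / fact m)"
  have summable: "summable (\<lambda>m. c (m + k) * w ^ m / fact m)" if "norm w < r" for k w
    using that
  proof (induction k arbitrary: w)
    case 0
    then show ?case using assms(1) by simp
  next
    case (Suc k)
    then show ?case
      using exp_type_series_summable_Suc[of r "\<lambda>m. c (m + k)" w] by simp
  qed
  have DERIV: "(F k has_field_derivative F (Suc k) w) (at w)" if "norm w < r" for k w
    using exp_type_series_DERIV[of r "\<lambda>m. c (m + k)" w] summable that by (simp add: F_def)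
  \<comment> \<open>The induction runs over all \<open>w\<close> in the disk at once: to
    differentiate again, the formula for the previous iterate must hold on a neighbourhood of
    \<open>w\<close>, not only at \<open>w\<close>.\<close>
  have "(deriv ^^ k) (F 0) w = F k w \<and> ((deriv ^^ k) (F 0) has_field_derivative F (Suc k) w) (at w)"
    if "norm w < r" for k w
    using that
  proof (induction k arbitrary: w)
    case 0
    then show ?case using DERIV by simp
  next
    case (Suc k)
    have eq: "(deriv ^^ Suc k) (F 0) u = F (Suc k) u" if "norm u < r" for u
      using Suc.IH[OF that] by (simp add: DERIV_imp_deriv)
    have "((deriv ^^ Suc k) (F 0) has_field_derivative F (Suc (Suc k)) w) (at w)"
    proof (rule has_field_derivative_transform_within_open[OF DERIV])
      show "open (ball 0 r :: complex set)" "w \<in> ball 0 r" using Suc.prems by auto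
    qed (use eq Suc.prems in auto)
    then show ?case using eq Suc.prems by blast
  qed
  from this[OF assms(2), of k] show ?thesis
    by (auto simp: F_def field_differentiable_def)
qed

section \<open>Convergence of the hypergeometric series\<close>

lemma ext_beta_norm_bound:
  assumes "\<And>m. ext_beta_converges \<Theta> b d (x + of_nat m) y"
  obtains C where "\<And>m. norm (ext_beta \<Theta> b d (x + of_nat m) y) \<le> C"
proof
  fix m
  let ?f = "\<lambda>m. ext_beta_integrand \<Theta> b d (x + of_nat m) y"
  have int: "set_integrable lborel {0<..<1} (?f m)" for m
    using assms by (simp add: ext_beta_converges_def)
  have le: "norm (?f m t) \<le> norm (?f 0 t)" if t: "t \<in> {0<..<1}" for t
  proof -
    \<comment> \<open>Only the power of \<open>t\<close> depends on \<open>m\<close>; its norm is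
      the real power with exponent the real part, which decreases in the exponent for 0 < t < 1.
      Hence the integrand for \<open>m = 0\<close> dominates all others.\<close>
    have "t powr (Re x + real m - 1) \<le> t powr (Re x - 1)"
      using t by (intro powr_mono') auto
    then have "norm (complex_of_real t powr (x + of_nat m - 1)) \<le>
        norm (complex_of_real t powr (x - 1))"
      using t by (simp add: norm_powr_real_powr)
    then show ?thesis
      by (auto simp: ext_beta_integrand_def norm_mult intro!: mult_right_mono)
  qed
  have "norm (ext_beta \<Theta> b d (x + of_nat m) y) \<le> (LINT t:{0<..<1}|lborel. norm (?f m t))"
    unfolding ext_beta_def by (rule set_integral_norm_bound[OF int])
  also have "\<dots> \<le> (LINT t:{0<..<1}|lborel. norm (?f 0 t))"
    by (intro set_integral_mono set_integrable_norm int le)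
  finally show "norm (ext_beta \<Theta> b d (x + of_nat m) y) \<le> (LINT t:{0<..<1}|lborel. norm (?f 0 t))" .
qed

lemma ext_beta_prod_norm_bound:
  assumes "\<forall>j\<in>J. \<forall>m. ext_beta_converges \<Theta> b d (x j + of_nat m) (y j)"
  shows "\<exists>C. \<forall>m. norm (\<Prod>j\<in>J. ext_beta \<Theta> b d (x j + of_nat m) (y j) / w j) \<le> C"
proof -
  have "\<exists>C. \<forall>m. norm (ext_beta \<Theta> b d (x j + of_nat m) (y j)) \<le> C" if "j \<in> J" for j
    using ext_beta_norm_bound assms that by metis
  then obtain C where C: "\<And>j m. j \<in> J \<Longrightarrow> norm (ext_beta \<Theta> b d (x j + of_nat m) (y j)) \<le> C j"
    by metis
  have "norm (\<Prod>j\<in>J. ext_beta \<Theta> b d (x j + of_nat m) (y j) / w j) \<le> (\<Prod>j\<in>J. C j / norm (w j))" for m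
    unfolding prod_norm[symmetric]
    by (intro prod_mono) (auto simp: norm_divide intro!: divide_right_mono C)
  then show ?thesis by blast
qed

text \<open>Up to signs these are the terms of the binomial series of (1 - z) to the power -a, whose
  radius of convergence is at least 1.\<close>

lemma summable_pochhammer_power_div_fact:
  fixes a z :: complex
  assumes "norm z < 1"
  shows "summable (\<lambda>m. norm (pochhammer a m * z ^ m / fact m))"
proof -
  have "norm (pochhammer a m * z ^ m / fact m) = norm (((- a) gchoose m) * z ^ m)" for m
    by (simp add: gbinomial_pochhammer norm_mult norm_divide norm_power)
  moreover have "summable (\<lambda>m. norm (((- a) gchoose m) * z ^ m))"
  proof (rule abs_summable_in_conv_radius)
    have "conv_radius (\<lambda>m. (- a) gchoose m) \<ge> 1"
      by (simp add: conv_radius_gchoose)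
    moreover have "ereal (norm z) < 1" using assms by simp
    ultimately show "ereal (norm z) < conv_radius (\<lambda>m. (- a) gchoose m)"
      by (rule less_le_trans[rotated])
  qed
  ultimately show ?thesis by simp
qed

text \<open>The factors b + k never vanish and grow in norm, so one positive \<delta> lies below all
  of them. Such a crude geometric bound suffices, because the factorial in the series outgrows every
  geometric sequence.\<close>

lemma pochhammer_norm_lower_bound:
  fixes b :: complex
  assumes "b \<notin> \<int>\<^sub>\<le>\<^sub>0"
  obtains \<delta> where "\<delta> > 0" and "\<And>m. norm (pochhammer b m) \<ge> \<delta> ^ m"
proof -
  \<comment> \<open>For k \<ge> N the factor b + k has norm at least k - |b| > 1. The element 1
    inserted into the minimum covers this tail; the finitely many earlier factors enter
    explicitly.\<close>
  obtain N where N: "real N > norm b + 1" using reals_Archimedean2 by blast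
  define \<delta> where "\<delta> = Min (insert 1 ((\<lambda>k. norm (b + of_nat k)) ` {..<N}))"
  have nz: "b + of_nat k \<noteq> 0" for k
    using assms by (metis add_eq_0_iff2 minus_of_nat_in_nonpos_Ints)
  have "\<delta> > 0" unfolding \<delta>_def using nz by (subst Min_gr_iff) auto
  have \<delta>: "\<delta> \<le> norm (b + of_nat k)" for k
  proof (cases "k < N")
    case True
    then show ?thesis unfolding \<delta>_def by (intro Min_le) auto
  next
    case False
    have "\<delta> \<le> 1" unfolding \<delta>_def by (intro Min_le) auto
    also have "1 \<le> real k - norm b" using False N by linarith
    also have "\<dots> \<le> norm (b + of_nat k)"
      using norm_diff_ineq[of "of_nat k" b] by (simp add: add.commute)
    finally show ?thesis .
  qed
  have "norm (pochhammer b m) \<ge> \<delta> ^ m" for m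
  proof -
    have "(\<Prod>k<m. \<delta>) \<le> (\<Prod>k<m. norm (b + of_nat k))"
      using \<open>\<delta> > 0\<close> by (intro prod_mono) (auto intro: \<delta>)
    then show ?thesis
      by (simp add: pochhammer_prod prod_norm atLeast0LessThan)
  qed
  with \<open>\<delta> > 0\<close> show thesis by (rule that)
qed

text \<open>The geometric lower bounds multiply to \<open>D ^ m\<close>, so the exponential series
  at \<open>norm z / D\<close> is a majorant.\<close>

lemma summable_power_div_prod_pochhammer_fact:
  fixes b :: "nat \<Rightarrow> complex" and z :: complex
  assumes "finite J" and "\<forall>j\<in>J. b j \<notin> \<int>\<^sub>\<le>\<^sub>0"
  shows "summable (\<lambda>m. norm (1 / (\<Prod>j\<in>J. pochhammer (b j) m) * z ^ m / fact m))"
proof -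
  have "\<exists>\<delta>. \<delta> > 0 \<and> (\<forall>m. norm (pochhammer (b j) m) \<ge> \<delta> ^ m)" if "j \<in> J" for j
    using pochhammer_norm_lower_bound assms(2) that by metis
  then obtain \<delta> where \<delta>: "\<And>j. j \<in> J \<Longrightarrow> \<delta> j > 0"
      "\<And>j m. j \<in> J \<Longrightarrow> norm (pochhammer (b j) m) \<ge> \<delta> j ^ m"
    by metis
  define D where "D = (\<Prod>j\<in>J. \<delta> j)"
  have "D > 0" unfolding D_def using \<delta>(1) by (intro prod_pos) auto
  have le: "D ^ m \<le> norm (\<Prod>j\<in>J. pochhammer (b j) m)" for m
    unfolding D_def prod_power_distrib prod_norm[symmetric] using \<delta>
    by (intro prod_mono) (auto simp: less_imp_le)
  have "norm (1 / (\<Prod>j\<in>J. pochhammer (b j) m) * z ^ m / fact m) \<le>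
      inverse (fact m) * (norm z / D) ^ m" for m
  proof -
    have "norm z ^ m / fact m / norm (\<Prod>j\<in>J. pochhammer (b j) m) \<le> norm z ^ m / fact m / D ^ m"
      using \<open>D > 0\<close> by (intro divide_left_mono le mult_pos_pos less_le_trans[OF _ le]) auto
    then show ?thesis
      by (simp add: norm_mult norm_divide norm_power field_simps)
  qed
  then show ?thesis
    by (intro summable_comparison_test'[OF summable_exp[of "norm z / D"], of 0]) auto
qed

lemma summable_ext_hyp:
  assumes "ext_hyp_defined \<Theta> p q \<alpha> \<beta> b d z"
  shows "summable (\<lambda>m. ext_hyp_coeff \<Theta> p q \<alpha> \<beta> b d m * z ^ m / fact m)"
proof -
  \<comment> \<open>Every coefficient is an explicit factor \<open>f m\<close> times a product
    \<open>g m\<close> of beta quotients. The latter is bounded in \<open>m\<close>, so absolute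
    summability with \<open>f\<close> alone is enough.\<close>
  have main: "summable (\<lambda>m. f m * g m * z ^ m / fact m)"
    if f: "summable (\<lambda>m. norm (f m * z ^ m / fact m))" and g: "\<exists>C. \<forall>m. norm (g m) \<le> C"
    for f g :: "nat \<Rightarrow> complex"
  proof -
    obtain C where C: "\<And>m. norm (g m) \<le> C" using g by blast
    show ?thesis
    proof (rule summable_comparison_test'[OF summable_mult[OF f, of C]])
      fix m
      have "norm (f m * g m * z ^ m / fact m) = norm (g m) * norm (f m * z ^ m / fact m)"
        by (simp add: norm_mult norm_divide)
      also have "\<dots> \<le> C * norm (f m * z ^ m / fact m)"
        using C by (intro mult_right_mono) auto
      finally show "norm (f m * g m * z ^ m / fact m) \<le> C * norm (f m * z ^ m / fact m)" .
    qed
  qed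
  consider "p = q + 1" | "p = q" | "p < q"
    using assms by (auto simp: ext_hyp_defined_def split: if_splits)
  then show ?thesis
  proof cases
    case 1
    then have "norm z < 1" and conv: "\<forall>j\<in>{1..q}. \<forall>m.
        ext_beta_converges \<Theta> b d (\<alpha> (j + 1) + of_nat m) (\<beta> j - \<alpha> (j + 1))"
      using assms by (auto simp: ext_hyp_defined_def)
    have "\<exists>C. \<forall>m. norm (\<Prod>j=1..q. ext_beta \<Theta> b d (\<alpha> (j + 1) + of_nat m) (\<beta> j - \<alpha> (j + 1)) /
        Beta (\<alpha> (j + 1)) (\<beta> j - \<alpha> (j + 1))) \<le> C"
      by (rule ext_beta_prod_norm_bound[OF conv])
    from main[OF summable_pochhammer_power_div_fact[OF \<open>norm z < 1\<close>] this] show ?thesis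
      using 1 by (simp add: ext_hyp_coeff_def)
  next
    case 2
    then have conv: "\<forall>j\<in>{1..q}. \<forall>m. ext_beta_converges \<Theta> b d (\<alpha> j + of_nat m) (\<beta> j - \<alpha> j)"
      using assms by (auto simp: ext_hyp_defined_def)
    have C: "\<exists>C. \<forall>m. norm (\<Prod>j=1..q. ext_beta \<Theta> b d (\<alpha> j + of_nat m) (\<beta> j - \<alpha> j) /
        Beta (\<alpha> j) (\<beta> j - \<alpha> j)) \<le> C"
      by (rule ext_beta_prod_norm_bound[OF conv])
    \<comment> \<open>For p = q the explicit factor is 1; this is the exponential series, obtained
      from the empty index set.\<close>
    have "summable (\<lambda>m. norm (1 * z ^ m / fact m))"
      using summable_power_div_prod_pochhammer_fact[of "{}" \<beta> z] by simp
    from main[OF this C] show ?thesis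
      using 2 by (simp add: ext_hyp_coeff_def)
  next
    case 3
    then have conv: "\<forall>j\<in>{1..p}. \<forall>m.
          ext_beta_converges \<Theta> b d (\<alpha> j + of_nat m) (\<beta> (q - p + j) - \<alpha> j)"
      and \<beta>: "\<forall>j\<in>{1..q - p}. \<beta> j \<notin> \<int>\<^sub>\<le>\<^sub>0"
      using assms by (auto simp: ext_hyp_defined_def)
    have C: "\<exists>C. \<forall>m. norm (\<Prod>j=1..p. ext_beta \<Theta> b d (\<alpha> j + of_nat m) (\<beta> (q - p + j) - \<alpha> j) /
        Beta (\<alpha> j) (\<beta> (q - p + j) - \<alpha> j)) \<le> C"
      by (rule ext_beta_prod_norm_bound[OF conv])
    from main[OF summable_power_div_prod_pochhammer_fact[OF finite_atLeastAtMost \<beta>] C] show ?thesis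
      using 3 by (simp add: ext_hyp_coeff_def)
  qed
qed

section \<open>Shifting all parameters by \<open>n\<close>\<close>

lemma add_of_nat_not_nonpos_Ints: "x \<notin> \<int>\<^sub>\<le>\<^sub>0 \<Longrightarrow> x + of_nat n \<notin> \<int>\<^sub>\<le>\<^sub>0" for x :: complex
  using nonpos_Ints_diff_Nats[of "x + of_nat n" "of_nat n"] by auto

text \<open>The differences of paired parameters do not change, so the \<open>m\<close>-th integral
  after the shift is the original one with index \<open>n + m\<close>.\<close>

lemma ext_hyp_defined_shift:
  assumes "ext_hyp_defined \<Theta> p q \<alpha> \<beta> b d z"
  shows "ext_hyp_defined \<Theta> p q (\<lambda>j. \<alpha> j + of_nat n) (\<lambda>j. \<beta> j + of_nat n) b d z"
proof -
  have conv: "ext_beta_converges \<Theta> b d (x + of_nat n + of_nat m) y"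
    if "\<And>m. ext_beta_converges \<Theta> b d (x + of_nat m) y" for x y m
    using that[of "n + m"] by (simp add: add_ac)
  show ?thesis
    using assms
    by (auto simp: ext_hyp_defined_def conv add_of_nat_not_nonpos_Ints add_pos_nonneg split: if_splits)
qed

lemma ext_hyp_coeff_shift:
  assumes "ext_hyp_defined \<Theta> p q \<alpha> \<beta> b d z"
  shows "ext_hyp_coeff \<Theta> p q \<alpha> \<beta> b d (m + n) =
         (\<Prod>j=1..p. pochhammer (\<alpha> j) n) / (\<Prod>j=1..q. pochhammer (\<beta> j) n) *
         ext_hyp_coeff \<Theta> p q (\<lambda>j. \<alpha> j + of_nat n) (\<lambda>j. \<beta> j + of_nat n) b d m"
proof -
  \<comment> \<open>\<open>Q x y k\<close> is the factor that a pair of an upper parameter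
    \<open>x\<close> and a lower parameter \<open>y\<close> contributes; the three cases differ only
    in the pairing and in the parameters left over.\<close>
  define Q where "Q = (\<lambda>x y k. ext_beta \<Theta> b d (x + of_nat k) (y - x) / Beta x (y - x))"
  have Q: "Q x y (m + n) = pochhammer x n / pochhammer y n * Q (x + of_nat n) (y + of_nat n) m"
    if "Re y > Re x \<and> Re x > 0" for x y
  proof -
    have "x \<notin> \<int>\<^sub>\<le>\<^sub>0" "y \<notin> \<int>\<^sub>\<le>\<^sub>0"
      using that by (auto elim!: nonpos_Ints_cases)
    then have nz: "pochhammer x n \<noteq> 0" "pochhammer y n \<noteq> 0"
      by (auto simp: pochhammer_eq_0_iff)
    have shift: "x + of_nat n + (y - x) = y + of_nat n"
      by simp
    have "Gamma x \<noteq> 0" "Gamma y \<noteq> 0"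
      using \<open>x \<notin> \<int>\<^sub>\<le>\<^sub>0\<close> \<open>y \<notin> \<int>\<^sub>\<le>\<^sub>0\<close> by (auto simp: Gamma_eq_zero_iff)
    \<comment> \<open>In the Gamma quotient for Beta the factor Gamma (y - x) stays, while Gamma x
      and Gamma y each gain a Pochhammer symbol.\<close>
    then have "Beta (x + of_nat n) (y - x) = Beta x (y - x) * pochhammer x n / pochhammer y n"
      using \<open>x \<notin> \<int>\<^sub>\<le>\<^sub>0\<close> \<open>y \<notin> \<int>\<^sub>\<le>\<^sub>0\<close> by (simp add: Beta_def shift pochhammer_Gamma)
    then show ?thesis using nz by (simp add: Q_def add_ac)
  qed
  have Q_prod: "(\<Prod>j\<in>J. Q (x j) (y j) (m + n)) =
      (\<Prod>j\<in>J. pochhammer (x j) n) / (\<Prod>j\<in>J. pochhammer (y j) n) *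
      (\<Prod>j\<in>J. Q (x j + of_nat n) (y j + of_nat n) m)"
    if "\<forall>j\<in>J. Re (y j) > Re (x j) \<and> Re (x j) > 0" for x y and J :: "nat set"
    unfolding prod_dividef[symmetric] prod.distrib[symmetric] using that
    by (intro prod.cong refl Q) auto
  \<comment> \<open>This handles the unpaired parameters: \<open>\<alpha> 1\<close> if p = q + 1,
    and the first q - p values of \<beta> if p < q.\<close>
  have poch: "pochhammer x (m + n) = pochhammer x n * pochhammer (x + of_nat n) m" for x :: complex
    by (simp add: pochhammer_product' add.commute[of m n])
  consider "p = q + 1" | "p = q" | "p < q"
    using assms by (auto simp: ext_hyp_defined_def split: if_splits)
  then show ?thesis
  proof cases
    case 1
    have coeff: "ext_hyp_coeff \<Theta> p q a c b d k =
        pochhammer (a 1) k * (\<Prod>j=1..q. Q (a (j + 1)) (c j) k)" for a c k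
      using 1 by (simp add: ext_hyp_coeff_def Q_def)
    have par: "\<forall>j\<in>{1..q}. Re (\<beta> j) > Re (\<alpha> (j + 1)) \<and> Re (\<alpha> (j + 1)) > 0"
      using assms 1 by (auto simp: ext_hyp_defined_def)
    \<comment> \<open>Here \<open>\<alpha> (j + 1)\<close> is paired with \<open>\<beta> j\<close>,
      so \<open>\<alpha> 1\<close> is split off and the remaining indices move down by one.\<close>
    have "(\<Prod>j=1..p. pochhammer (\<alpha> j) n) =
        pochhammer (\<alpha> 1) n * (\<Prod>j=1..q. pochhammer (\<alpha> (j + 1)) n)"
      using 1 prod.atLeast_Suc_atMost[of 1 p "\<lambda>j. pochhammer (\<alpha> j) n"]
        prod.shift_bounds_cl_Suc_ivl[of "\<lambda>j. pochhammer (\<alpha> j) n" 1 q]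
      by (simp del: prod.cl_ivl_Suc)
    then show ?thesis
      unfolding coeff poch Q_prod[OF par] by simp
  next
    case 2
    have coeff: "ext_hyp_coeff \<Theta> p q a c b d k = (\<Prod>j=1..q. Q (a j) (c j) k)" for a c k
      using 2 by (simp add: ext_hyp_coeff_def Q_def)
    have par: "\<forall>j\<in>{1..q}. Re (\<beta> j) > Re (\<alpha> j) \<and> Re (\<alpha> j) > 0"
      using assms 2 by (auto simp: ext_hyp_defined_def)
    show ?thesis
      unfolding coeff Q_prod[OF par] using 2 by simp
  next
    case 3
    have coeff: "ext_hyp_coeff \<Theta> p q a c b d k =
        1 / (\<Prod>j=1..q - p. pochhammer (c j) k) * (\<Prod>j=1..p. Q (a j) (c (q - p + j)) k)" for a c k
      using 3 by (simp add: ext_hyp_coeff_def Q_def)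
    have par: "\<forall>j\<in>{1..p}. Re (\<beta> (q - p + j)) > Re (\<alpha> j) \<and> Re (\<alpha> j) > 0"
      using assms 3 by (auto simp: ext_hyp_defined_def)
    have "(\<Prod>j=1..q. pochhammer (\<beta> j) n) =
        (\<Prod>j=1..q - p. pochhammer (\<beta> j) n) * (\<Prod>j=1..p. pochhammer (\<beta> (q - p + j)) n)"
      using 3 prod.ub_add_nat[of 1 "q - p" "\<lambda>j. pochhammer (\<beta> j) n" p]
        prod.shift_bounds_cl_nat_ivl[of "\<lambda>j. pochhammer (\<beta> j) n" 1 "q - p" p]
      by (simp add: add.commute)
    then show ?thesis
      unfolding coeff poch Q_prod[OF par] prod.distrib by simp
  qed
qed

theorem theorem2p2:
  fixes \<kappa> :: "nat \<Rightarrow> complex" and R M\<^sub>0 :: real and \<omega> :: complex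
    and \<Theta> :: "complex \<Rightarrow> complex"
    and p q n :: nat and \<alpha> \<beta> :: "nat \<Rightarrow> complex" and b d z :: complex
  assumes "ext_kernel \<kappa> R M\<^sub>0 \<omega> \<Theta>"
    and "p \<le> q + 1"
    and "ext_hyp_defined \<Theta> p q \<alpha> \<beta> b d z"
  shows "(\<forall>k<n. (deriv ^^ k) (ext_hyp \<Theta> p q \<alpha> \<beta> b d) field_differentiable at z) \<and>
         (deriv ^^ n) (ext_hyp \<Theta> p q \<alpha> \<beta> b d) z =
           (\<Prod>j=1..p. pochhammer (\<alpha> j) n) / (\<Prod>j=1..q. pochhammer (\<beta> j) n) *
           ext_hyp \<Theta> p q (\<lambda>j. \<alpha> j + of_nat n) (\<lambda>j. \<beta> j + of_nat n) b d z"
proof -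
  let ?c = "ext_hyp_coeff \<Theta> p q \<alpha> \<beta> b d"
  let ?c' = "ext_hyp_coeff \<Theta> p q (\<lambda>j. \<alpha> j + of_nat n) (\<lambda>j. \<beta> j + of_nat n) b d"
  let ?K = "(\<Prod>j=1..p. pochhammer (\<alpha> j) n) / (\<Prod>j=1..q. pochhammer (\<beta> j) n)"
  \<comment> \<open>The function must be defined on an open disk around 0 containing
    \<open>z\<close>. For p = q + 1 this is the unit disk; otherwise the conditions do not involve
    \<open>z\<close>, and any radius above \<open>norm z\<close> works.\<close>
  define r where "r = (if p = q + 1 then 1 else norm z + 1)"
  have "norm z < r"
    using assms(3) by (simp add: r_def ext_hyp_defined_def)
  have "ext_hyp_defined \<Theta> p q \<alpha> \<beta> b d w" if "norm w < r" for w
    using assms(3) that by (auto simp: r_def ext_hyp_defined_def split: if_splits)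
  then have summable: "summable (\<lambda>m. ?c m * w ^ m / fact m)" if "norm w < r" for w
    using that summable_ext_hyp by blast
  have hyp: "ext_hyp \<Theta> p q \<alpha> \<beta> b d = (\<lambda>w. \<Sum>m. ?c m * w ^ m / fact m)"
    by (simp add: ext_hyp_def fun_eq_iff)
  note higher = exp_type_series_higher_deriv[of r ?c z, OF summable \<open>norm z < r\<close>, folded hyp]
  have "(deriv ^^ n) (ext_hyp \<Theta> p q \<alpha> \<beta> b d) z = (\<Sum>m. ?K * (?c' m * z ^ m / fact m))"
    by (simp add: higher[THEN conjunct1] ext_hyp_coeff_shift[OF assms(3)] mult.assoc)
  also have "\<dots> = ?K * (\<Sum>m. ?c' m * z ^ m / fact m)"
    by (intro suminf_mult summable_ext_hyp ext_hyp_defined_shift[OF assms(3)])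
  also have "\<dots> = ?K * ext_hyp \<Theta> p q (\<lambda>j. \<alpha> j + of_nat n) (\<lambda>j. \<beta> j + of_nat n) b d z"
    by (simp add: ext_hyp_def)
  finally show ?thesis using higher by blast
qed

end
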